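(* For all real numbers $a,b>0$ with $a\neq b$, writing $A=A(a,b)$, $G=G(a,b)$, $P=P(a,b)$, $X=X(a,b)$, the following hold. (i) $$\alpha G+(1-\alpha)A<X<\beta G+(1-\beta)A$$ with $\alpha=2/3$ and $\beta=(e-1)/e$, and these constants are best possible (that is, for the inequalities to hold for all $a,b>0$ with $a\ne b$, $\alpha$ cannot be replaced by a smaller number and $\beta$ cannot be replaced by a larger number). (ii) $$A+G-\alpha_1 P<X<A+G-\beta_1 P$$ with $\alpha_1=1$ and $\beta_1=\pi(e-1)/(2e)$, and these constants are best possible (that is, for the inequalities to hold for all $a,b>0$ with $a\ne b$, $\alpha_1$ cannot be replaced by a smaller number and $\beta_1$ cannot be replaced by a larger number).
   Context: For $a,b>0$ with $a\neq b$: $A(a,b)=\frac{a+b}{2}$ (arithmetic mean), $G(a,b)=\sqrt{ab}$ (geometric mean), $P(a,b)=\dfrac{a-b}{2\arcsin\left(\frac{a-b}{a+b}\right)}$ (Seiffert mean), and $X(a,b)=A\,e^{G/P-1}$ (Sándor mean). *)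

theory Defs
  imports Complex_Main
begin

definition arith_mean :: "real \<Rightarrow> real \<Rightarrow> real" where
  "arith_mean a b = (a + b) / 2"

definition geom_mean :: "real \<Rightarrow> real \<Rightarrow> real" where
  "geom_mean a b = sqrt (a * b)"

(* The Seiffert and Sandor means are only meant for positive a \<noteq> b; for a = b the quotient
   below is 0 / 0 = 0, and the customary convention P(a,a) = X(a,a) = a is not imposed. *)
definition seiffert_mean :: "real \<Rightarrow> real \<Rightarrow> real" where
  "seiffert_mean a b = (a - b) / (2 * arcsin ((a - b) / (a + b)))"

definition sandor_mean :: "real \<Rightarrow> real \<Rightarrow> real" where
  "sandor_mean a b = arith_mean a b * exp (geom_mean a b / seiffert_mean a b - 1)"

end

theory Submission
  imports Defs "HOL-Real_Asymp.Real_Asymp"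
begin

text \<open>
  All four means are homogeneous and symmetric, so the theorem is about functions of one variable.
  Put \<open>\<bar>a - b\<bar> / (a + b) = sin x\<close> with \<open>0 < x < \<pi>/2\<close>. Then \<open>G/A = cos x\<close>, \<open>P/A = sin x / x\<close> and
  \<open>X/A = E x\<close> with \<open>E x = exp (x cot x - 1)\<close>, and every such \<open>x\<close> comes from some pair \<open>a, b\<close>.
  Solving the two comparisons for their constants, they say that the quotients
  \<open>(1 - E) / (1 - cos)\<close> and \<open>x (1 + cos - E) / sin\<close>
  lie between \<open>(e - 1) / e\<close> and \<open>2/3\<close>, and between \<open>\<pi> (e - 1) / (2 e)\<close> and \<open>1\<close>. These constants are
  the limits of the quotients at \<open>\<pi>/2\<close> and at \<open>0\<close>, so everything, including that the constants are
  best possible, follows once both quotients are strictly decreasing.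

  The point is that both derivatives are a positive factor times the same expression
  \<open>E x (x + sin x) - sin x (1 + cos x)\<close>, so one inequality,
  \<open>exp (x cot x - 1) < sin x (1 + cos x) / (x + sin x)\<close>, settles both parts
  (lemma \<open>sandor_profile_upper_bound\<close>). The logarithm of its right side minus that of its left
  side tends to \<open>0\<close> at \<open>0\<close>, and the derivative of this difference has the sign of
  \<open>x\<^sup>2 + x sin x cos x - 2 sin\<^sup>2 x\<close>, which is positive by a Wilker-type inequality
  (lemma \<open>wilker_type_inequality\<close>).
\<close>

section \<open>Decreasing functions and their one-sided limits\<close>

lemma less_right_limit_if_deriv_neg:
  fixes f :: "real \<Rightarrow> real"
  assumes deriv: "\<And>y. a < y \<Longrightarrow> y < b \<Longrightarrow> \<exists>D. DERIV f y :> D \<and> D < 0"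
    and lim: "(f \<longlongrightarrow> L) (at_right a)"
    and x: "a < x" "x < b"
  shows "f x < L"
proof -
  \<comment> \<open>An intermediate point keeps the inequality strict in the limit.\<close>
  define y where "y = (a + x) / 2"
  have y: "a < y" "y < x" using x by (auto simp: y_def)
  have decr: "f v < f u" if "a < u" "u < v" "v < b" for u v
    using that by (intro DERIV_neg_imp_decreasing[of u v f] deriv) auto
  have "eventually (\<lambda>z. f y \<le> f z) (at_right a)"
    using eventually_at_right_less[of a] eventually_at_right_real[OF y(1)]
    by eventually_elim (use decr y x in \<open>auto intro: less_imp_le\<close>)
  hence "f y \<le> L" by (intro tendsto_lowerbound[OF lim]) auto
  moreover have "f x < f y" using decr y x by auto
  ultimately show ?thesis by simp
qed

lemma greater_left_limit_if_deriv_neg: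
  fixes f :: "real \<Rightarrow> real"
  assumes deriv: "\<And>y. a < y \<Longrightarrow> y < b \<Longrightarrow> \<exists>D. DERIV f y :> D \<and> D < 0"
    and lim: "(f \<longlongrightarrow> L) (at_left b)"
    and x: "a < x" "x < b"
  shows "L < f x"
proof -
  define y where "y = (x + b) / 2"
  have y: "x < y" "y < b" using x by (auto simp: y_def)
  have decr: "f v < f u" if "a < u" "u < v" "v < b" for u v
    using that by (intro DERIV_neg_imp_decreasing[of u v f] deriv) auto
  have "eventually (\<lambda>z. f z \<le> f y) (at_left b)"
    using eventually_at_left_real[OF y(2)]
    by eventually_elim (use decr y x in \<open>auto intro: less_imp_le\<close>)
  hence "L \<le> f y" by (intro tendsto_upperbound[OF lim]) auto
  moreover have "f y < f x" using decr y x by auto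
  ultimately show ?thesis by simp
qed

section \<open>A Wilker-type inequality\<close>

lemma sin_cos_pos:
  fixes x :: real
  assumes "0 < x" "x < pi / 2"
  shows "0 < sin x" "0 < cos x" "cos x < 1"
proof -
  show "0 < sin x" using assms by (intro sin_gt_zero) auto
  show "0 < cos x" using assms by (intro cos_gt_zero) auto
  show "cos x < 1" using cos_monotone_0_pi[of 0 x] assms by auto
qed

lemma x_mult_cos_less_sin:
  fixes x :: real
  assumes x: "0 < x" "x < pi / 2"
  shows "x * cos x < sin x"
proof -
  have "(\<lambda>t::real. sin t - t * cos t) 0 < (\<lambda>t. sin t - t * cos t) x"
  proof (rule DERIV_pos_imp_increasing_open[OF x(1)])
    fix t :: real assume t: "0 < t" "t < x"
    have "DERIV (\<lambda>t. sin t - t * cos t) t :> t * sin t"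
      by (auto intro!: derivative_eq_intros)
    moreover have "0 < t * sin t" using t x sin_cos_pos[of t] by auto
    ultimately show "\<exists>y. DERIV (\<lambda>t. sin t - t * cos t) t :> y \<and> 0 < y" by blast
  qed (auto intro!: continuous_intros)
  thus ?thesis by simp
qed

lemma sin_less_self:
  fixes x :: real
  assumes x: "0 < x" "x < pi / 2"
  shows "sin x < x"
proof -
  have "(\<lambda>t::real. t - sin t) 0 < (\<lambda>t. t - sin t) x"
  proof (rule DERIV_pos_imp_increasing_open[OF x(1)])
    fix t :: real assume t: "0 < t" "t < x"
    have "DERIV (\<lambda>t. t - sin t) t :> 1 - cos t"
      by (auto intro!: derivative_eq_intros)
    moreover have "0 < 1 - cos t" using t x sin_cos_pos[of t] by auto
    ultimately show "\<exists>y. DERIV (\<lambda>t. t - sin t) t :> y \<and> 0 < y" by blast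
  qed (auto intro!: continuous_intros)
  thus ?thesis by simp
qed

text \<open>
  In the variable \<open>2 x\<close> this is the Cusa--Huygens inequality \<open>3 sin y < y (2 + cos y)\<close>.
\<close>

lemma cusa_huygens_double_angle:
  fixes x :: real
  assumes x: "0 < x" "x < pi / 2"
  shows "0 < 2 * x - 3 * sin x * cos x + x * ((cos x)\<^sup>2 - (sin x)\<^sup>2)"
proof -
  define f :: "real \<Rightarrow> real"
    where "f t = 2 * t - 3 * sin t * cos t + t * ((cos t)\<^sup>2 - (sin t)\<^sup>2)" for t
  have "f 0 < f x"
  proof (rule DERIV_pos_imp_increasing_open[OF x(1)])
    fix t :: real assume t: "0 < t" "t < x"
    have eq: "2 = 2 * (sin t)\<^sup>2 + 2 * (cos t)\<^sup>2" by (simp add: sin_squared_eq)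
    have "DERIV f t :> 2 - 2 * ((cos t)\<^sup>2 - (sin t)\<^sup>2) - 4 * t * sin t * cos t"
      unfolding f_def
      by (auto intro!: derivative_eq_intros simp: algebra_simps power2_eq_square)
    also have "2 - 2 * ((cos t)\<^sup>2 - (sin t)\<^sup>2) - 4 * t * sin t * cos t
        = 4 * sin t * (sin t - t * cos t)"
      by (subst eq) (simp add: algebra_simps power2_eq_square)
    finally have "DERIV f t :> 4 * sin t * (sin t - t * cos t)" .
    moreover have "0 < 4 * sin t * (sin t - t * cos t)"
      using t x sin_cos_pos[of t] x_mult_cos_less_sin[of t] by auto
    ultimately show "\<exists>y. DERIV f t :> y \<and> 0 < y" by blast
  qed (auto intro!: continuous_intros simp: f_def)
  thus ?thesis by (simp add: f_def)
qed

text \<open>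
  Divided by \<open>sin\<^sup>2 x\<close> this reads \<open>(x / sin x)\<^sup>2 + x / tan x > 2\<close>. The expression below vanishes
  at \<open>0\<close>, and its derivative is the expression in the preceding lemma.
\<close>

lemma wilker_type_inequality:
  fixes x :: real
  assumes x: "0 < x" "x < pi / 2"
  shows "0 < x\<^sup>2 + x * sin x * cos x - 2 * (sin x)\<^sup>2"
proof -
  define f :: "real \<Rightarrow> real"
    where "f t = t\<^sup>2 + t * sin t * cos t - 2 * (sin t)\<^sup>2" for t
  have "f 0 < f x"
  proof (rule DERIV_pos_imp_increasing_open[OF x(1)])
    fix t :: real assume t: "0 < t" "t < x"
    have "DERIV f t :> 2 * t - 3 * sin t * cos t + t * ((cos t)\<^sup>2 - (sin t)\<^sup>2)"
      unfolding f_def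
      by (auto intro!: derivative_eq_intros simp: algebra_simps power2_eq_square)
    moreover have "0 < 2 * t - 3 * sin t * cos t + t * ((cos t)\<^sup>2 - (sin t)\<^sup>2)"
      using t x cusa_huygens_double_angle[of t] by auto
    ultimately show "\<exists>y. DERIV f t :> y \<and> 0 < y" by blast
  qed (auto intro!: continuous_intros simp: f_def)
  thus ?thesis by (simp add: f_def)
qed

section \<open>The normalised Sandor mean\<close>

text \<open>The quotient \<open>X/A\<close> as a function of \<open>x = arcsin (\<bar>a - b\<bar> / (a + b))\<close>.\<close>

definition sandor_profile :: "real \<Rightarrow> real" where
  "sandor_profile x = exp (x * cos x / sin x - 1)"

lemma DERIV_x_cot:
  fixes x :: real
  assumes "sin x \<noteq> 0"
  shows "DERIV (\<lambda>t. t * cos t / sin t - 1) x :> - ((x - sin x * cos x) / (sin x)\<^sup>2)"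
proof -
  have eq: "x = x * (sin x)\<^sup>2 + x * (cos x)\<^sup>2" by (simp flip: distrib_left)
  have "DERIV (\<lambda>t. t * cos t / sin t - 1) x :>
      ((cos x - x * sin x) * sin x - x * cos x * cos x) / (sin x * sin x)"
    using assms by (auto intro!: derivative_eq_intros)
  also have "(cos x - x * sin x) * sin x - x * cos x * cos x = - (x - sin x * cos x)"
    using eq by (simp add: algebra_simps power2_eq_square)
  finally show ?thesis by (simp only: power2_eq_square minus_divide_left)
qed

lemma DERIV_sandor_profile:
  assumes "sin x \<noteq> 0"
  shows "DERIV sandor_profile x :> - (sandor_profile x * (x - sin x * cos x) / (sin x)\<^sup>2)"
proof -
  have "DERIV (\<lambda>t. exp (t * cos t / sin t - 1)) x :>
      exp (x * cos x / sin x - 1) * - ((x - sin x * cos x) / (sin x)\<^sup>2)"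
    using DERIV_x_cot[OF assms] by (rule DERIV_fun_exp)
  thus ?thesis by (simp add: sandor_profile_def[abs_def])
qed

text \<open>
  In terms of the means this says \<open>X < P (A + G) / (A + P)\<close>. Taking logarithms removes the
  exponential, and differentiating then removes the logarithms.
\<close>

lemma sandor_profile_upper_bound:
  assumes x: "0 < x" "x < pi / 2"
  shows "sandor_profile x * (x + sin x) < sin x * (1 + cos x)"
proof -
  define f :: "real \<Rightarrow> real" where
    "f t = (t * cos t / sin t - 1) - ln (sin t) - ln (1 + cos t) + ln (t + sin t)" for t
  have pos: "0 < x + sin x" "0 < sin x" "0 < 1 + cos x" using x sin_cos_pos[of x] by auto
  have "f x < 0"
  proof (rule less_right_limit_if_deriv_neg[of 0 "pi / 2" f])
    fix t :: real assume t: "0 < t" "t < pi / 2"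
    note sc = sin_cos_pos[OF t]
    have p: "0 < t + sin t" "0 < 1 + cos t" using t sc by auto
    define D where "D = - ((t - sin t * cos t) / (sin t)\<^sup>2) - cos t / sin t
        + sin t / (1 + cos t) + (1 + cos t) / (t + sin t)"
    have "DERIV (\<lambda>t. ln (t + sin t) - ln (sin t) - ln (1 + cos t)) t :>
        (1 + cos t) / (t + sin t) - cos t / sin t + sin t / (1 + cos t)"
      using sc p by (auto intro!: derivative_eq_intros)
    from DERIV_add[OF DERIV_x_cot this] sc have "DERIV f t :> D"
      by (simp add: f_def[abs_def] D_def algebra_simps)
    moreover have "D = - ((t\<^sup>2 + t * sin t * cos t - 2 * (sin t)\<^sup>2) / ((sin t)\<^sup>2 * (t + sin t)))"
    proof -
      have half: "sin t / (1 + cos t) = (1 - cos t) / sin t"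
        using sc p sin_cos_squared_add[of t]
        by (simp add: frac_eq_eq algebra_simps power2_eq_square)
      show ?thesis unfolding D_def half using sc p
        by (simp add: divide_simps) (simp add: algebra_simps power2_eq_square)
    qed
    moreover have "0 < (t\<^sup>2 + t * sin t * cos t - 2 * (sin t)\<^sup>2) / ((sin t)\<^sup>2 * (t + sin t))"
      using wilker_type_inequality[OF t] sc p by auto
    ultimately show "\<exists>D. DERIV f t :> D \<and> D < 0" by auto
  next
    show "(f \<longlongrightarrow> 0) (at_right 0)" unfolding f_def by real_asymp
  qed (use x in auto)
  hence "x * cos x / sin x - 1 < ln (sin x * (1 + cos x) / (x + sin x))"
    using pos by (simp add: f_def ln_mult ln_div)
  hence "sandor_profile x < sin x * (1 + cos x) / (x + sin x)"
    unfolding sandor_profile_def using pos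
    by (metis exp_less_mono exp_ln divide_pos_pos mult_pos_pos)
  thus ?thesis using pos by (simp add: field_simps)
qed

section \<open>The two monotone quotients\<close>

text \<open>The quotient \<open>(A - X) / (A - G)\<close>.\<close>

definition geom_quotient :: "real \<Rightarrow> real" where
  "geom_quotient x = (1 - sandor_profile x) / (1 - cos x)"

text \<open>The quotient \<open>(A + G - X) / P\<close>.\<close>

definition seiffert_quotient :: "real \<Rightarrow> real" where
  "seiffert_quotient x = x * (1 + cos x - sandor_profile x) / sin x"

text \<open>
  The common factor \<open>E (x + sin x) - sin x (1 + cos x)\<close> appears here only after
  \<open>sin\<^sup>2 x\<close> is factored as \<open>(1 - cos x) (1 + cos x)\<close>, which cancels a factor \<open>1 - cos x\<close>.
\<close>

lemma geom_quotient_deriv_neg: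
  assumes x: "0 < x" "x < pi / 2"
  shows "\<exists>D. DERIV geom_quotient x :> D \<and> D < 0"
proof -
  note sc = sin_cos_pos[OF x]
  have sq: "(sin x)\<^sup>2 = (1 - cos x) * (1 + cos x)"
    using sin_cos_squared_add[of x] by (simp add: algebra_simps power2_eq_square)
  let ?E = "sandor_profile x"
  let ?D = "(?E * (x - sin x * cos x) / (sin x)\<^sup>2 * (1 - cos x) - (1 - ?E) * sin x)
        / ((1 - cos x) * (1 - cos x))"
  have "DERIV geom_quotient x :> ?D"
    unfolding geom_quotient_def[abs_def] using sc
    by (auto intro!: derivative_eq_intros DERIV_sandor_profile)
  moreover have "?D = (?E * (x + sin x) - sin x * (1 + cos x))
        / ((1 + cos x) * ((1 - cos x) * (1 - cos x)))"
    unfolding sq using sc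
    by (simp add: divide_simps) (simp add: algebra_simps)
  moreover have "(?E * (x + sin x) - sin x * (1 + cos x))
        / ((1 + cos x) * ((1 - cos x) * (1 - cos x))) < 0"
    using sandor_profile_upper_bound[OF x] sc by (intro divide_neg_pos) auto
  ultimately show ?thesis by metis
qed

text \<open>
  The same factor appears because the coefficient of \<open>E\<close> in the numerator of the derivative is
  \<open>x\<^sup>2 - sin\<^sup>2 x\<close> and the remaining terms are \<open>- sin x (1 + cos x) (x - sin x)\<close>, so that
  \<open>x - sin x\<close> splits off.
\<close>

lemma seiffert_quotient_deriv_neg:
  assumes x: "0 < x" "x < pi / 2"
  shows "\<exists>D. DERIV seiffert_quotient x :> D \<and> D < 0"
proof -
  note sc = sin_cos_pos[OF x]
  let ?E = "sandor_profile x"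
  let ?D = "((1 + cos x - ?E + x * (- sin x + ?E * (x - sin x * cos x) / (sin x)\<^sup>2)) * sin x
        - x * (1 + cos x - ?E) * cos x) / (sin x * sin x)"
  have sq: "(sin x)\<^sup>2 = 1 - (cos x)\<^sup>2" by (simp add: sin_squared_eq)
  have "DERIV seiffert_quotient x :> ?D"
    unfolding seiffert_quotient_def[abs_def] using sc
    by (auto intro!: derivative_eq_intros DERIV_sandor_profile simp: algebra_simps)
  moreover have "?D = (x - sin x) * (?E * (x + sin x) - sin x * (1 + cos x)) / (sin x) ^ 3"
  proof -
    have "?D = (sin x * ((1 + cos x - ?E) * (sin x - x * cos x))
        - x * sin x * (sin x)\<^sup>2 + x * ?E * (x - sin x * cos x)) / (sin x) ^ 3"
      using sc by (simp add: divide_simps) (simp add: algebra_simps power2_eq_square power3_eq_cube)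
    also have "sin x * ((1 + cos x - ?E) * (sin x - x * cos x))
        - x * sin x * (sin x)\<^sup>2 + x * ?E * (x - sin x * cos x)
        = (x - sin x) * (?E * (x + sin x) - sin x * (1 + cos x))"
      using sq by algebra
    finally show ?thesis .
  qed
  moreover have "(x - sin x) * (?E * (x + sin x) - sin x * (1 + cos x)) / (sin x) ^ 3 < 0"
    using sandor_profile_upper_bound[OF x] sc sin_less_self[OF x]
    by (intro divide_neg_pos mult_pos_neg) auto
  ultimately show ?thesis by metis
qed

lemma sandor_profile_tendsto_pi_half: "(sandor_profile \<longlongrightarrow> exp (-1)) (at_left (pi / 2))"
  unfolding sandor_profile_def[abs_def] by (auto intro!: tendsto_eq_intros)

lemma geom_quotient_tendsto_0: "(geom_quotient \<longlongrightarrow> 2 / 3) (at_right 0)"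
  unfolding geom_quotient_def[abs_def] sandor_profile_def by real_asymp

lemma geom_quotient_tendsto_pi_half:
  "(geom_quotient \<longlongrightarrow> (exp 1 - 1) / exp 1) (at_left (pi / 2))"
  unfolding geom_quotient_def[abs_def]
  by (auto intro!: tendsto_eq_intros sandor_profile_tendsto_pi_half
      simp: exp_minus field_simps)

lemma seiffert_quotient_tendsto_0: "(seiffert_quotient \<longlongrightarrow> 1) (at_right 0)"
  unfolding seiffert_quotient_def[abs_def] sandor_profile_def by real_asymp

lemma seiffert_quotient_tendsto_pi_half:
  "(seiffert_quotient \<longlongrightarrow> pi * (exp 1 - 1) / (2 * exp 1)) (at_left (pi / 2))"
  unfolding seiffert_quotient_def[abs_def]
  by (auto intro!: tendsto_eq_intros sandor_profile_tendsto_pi_half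
      simp: exp_minus field_simps)

section \<open>Trigonometric form of the means\<close>

lemma means_of_one_plus_minus_sin:
  assumes x: "0 < x" "x < pi / 2"
  defines "a \<equiv> 1 + sin x" and "b \<equiv> 1 - sin x"
  shows "0 < a" "0 < b" "a \<noteq> b"
    and "arith_mean a b = 1" "geom_mean a b = cos x"
    and "seiffert_mean a b = sin x / x" "sandor_mean a b = sandor_profile x"
proof -
  note sc = sin_cos_pos[OF x]
  have "sin x < 1" using sin_monotone_2pi[of x "pi / 2"] x by auto
  thus "0 < a" "0 < b" "a \<noteq> b" using sc by (auto simp: a_def b_def)
  show A: "arith_mean a b = 1" by (simp add: arith_mean_def a_def b_def)
  have "a * b = (cos x)\<^sup>2"
    using sin_cos_squared_add[of x] by (simp add: a_def b_def algebra_simps power2_eq_square)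
  thus G: "geom_mean a b = cos x" using sc by (simp add: geom_mean_def)
  have "arcsin (sin x) = x" using x by (intro arcsin_sin) auto
  thus P: "seiffert_mean a b = sin x / x" by (simp add: seiffert_mean_def a_def b_def)
  show "sandor_mean a b = sandor_profile x"
    unfolding sandor_mean_def A G P sandor_profile_def by (simp add: mult.commute)
qed

lemma means_eq_arith_mean_mult:
  assumes "0 < a" "0 < b" "a \<noteq> b"
  obtains x where "0 < x" "x < pi / 2"
    "geom_mean a b = arith_mean a b * cos x"
    "seiffert_mean a b = arith_mean a b * (sin x / x)"
    "sandor_mean a b = arith_mean a b * sandor_profile x"
proof -
  define s where "s = \<bar>a - b\<bar> / (a + b)"
  define x where "x = arcsin s"
  have s: "0 < s" "s < 1" using assms by (auto simp: s_def field_simps)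
  have sin_x: "sin x = s" using s by (simp add: x_def)
  have x0: "0 < x" using arcsin_less_arcsin[of 0 s] s by (simp add: x_def)
  have x1: "x < pi / 2" using arcsin_less_arcsin[of s 1] s by (simp add: x_def)
  let ?A = "arith_mean a b"
  have A: "0 < ?A" using assms by (simp add: arith_mean_def)
  have s_A: "?A * s = \<bar>a - b\<bar> / 2" using assms by (simp add: s_def arith_mean_def field_simps)
  have G: "geom_mean a b = ?A * cos x"
  proof -
    have "(?A * cos x)\<^sup>2 = ?A\<^sup>2 - (?A * s)\<^sup>2"
      using sin_cos_squared_add[of x] sin_x by algebra
    also have "\<dots> = a * b"
      unfolding s_A by (simp add: arith_mean_def power_divide) (simp add: field_simps power2_eq_square)
    finally show ?thesis
      unfolding geom_mean_def using A sin_cos_pos[OF x0 x1] by (intro real_sqrt_unique) auto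
  qed
  \<comment> \<open>Exchanging \<open>a\<close> and \<open>b\<close> changes the sign of numerator and denominator, as \<open>arcsin\<close> is odd.\<close>
  have "seiffert_mean a b = \<bar>a - b\<bar> / (2 * x)"
  proof (cases "a > b")
    case True thus ?thesis by (simp add: seiffert_mean_def x_def s_def)
  next
    case False
    hence "(a - b) / (a + b) = - s" by (simp add: s_def minus_divide_left)
    hence "arcsin ((a - b) / (a + b)) = - x" using s by (simp add: arcsin_minus x_def)
    thus ?thesis using False by (simp add: seiffert_mean_def minus_divide_left)
  qed
  hence P: "seiffert_mean a b = ?A * (sin x / x)"
    unfolding times_divide_eq_right sin_x s_A by simp
  have "geom_mean a b / seiffert_mean a b = x * cos x / sin x"
    unfolding G P using A x0 by simp
  hence "sandor_mean a b = ?A * sandor_profile x"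
    unfolding sandor_mean_def sandor_profile_def by simp
  with x0 x1 G P that show thesis by blast
qed

section \<open>Comparing the means\<close>

text \<open>
  The two forms of each comparison, solved for the constant; the signs come from
  \<open>1 - cos x > 0\<close> and \<open>sin x / x > 0\<close>.
\<close>

lemma geom_quotient_less_iff:
  assumes x: "0 < x" "x < pi / 2"
  shows "geom_quotient x < c \<longleftrightarrow> c * cos x + (1 - c) < sandor_profile x"
    and "c < geom_quotient x \<longleftrightarrow> sandor_profile x < c * cos x + (1 - c)"
  using sin_cos_pos[OF x]
  by (auto simp: geom_quotient_def pos_divide_less_eq pos_less_divide_eq algebra_simps)

lemma seiffert_quotient_less_iff:
  assumes x: "0 < x" "x < pi / 2"
  shows "seiffert_quotient x < c \<longleftrightarrow> 1 + cos x - c * (sin x / x) < sandor_profile x"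
    and "c < seiffert_quotient x \<longleftrightarrow> sandor_profile x < 1 + cos x - c * (sin x / x)"
  using sin_cos_pos[OF x] x by (auto simp: seiffert_quotient_def field_simps)

lemma bounds_geom_quotient:
  assumes "0 < x" "x < pi / 2"
  shows "(exp 1 - 1) / exp 1 < geom_quotient x" "geom_quotient x < 2 / 3"
  using greater_left_limit_if_deriv_neg[OF _ geom_quotient_tendsto_pi_half, of 0 x]
    less_right_limit_if_deriv_neg[OF _ geom_quotient_tendsto_0, of "pi / 2" x]
    geom_quotient_deriv_neg assms by auto

lemma bounds_seiffert_quotient:
  assumes "0 < x" "x < pi / 2"
  shows "pi * (exp 1 - 1) / (2 * exp 1) < seiffert_quotient x" "seiffert_quotient x < 1"
  using greater_left_limit_if_deriv_neg[OF _ seiffert_quotient_tendsto_pi_half, of 0 x]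
    less_right_limit_if_deriv_neg[OF _ seiffert_quotient_tendsto_0, of "pi / 2" x]
    seiffert_quotient_deriv_neg assms by auto

lemma exceeds_below_right_limit_0:
  fixes f :: "real \<Rightarrow> real"
  assumes "(f \<longlongrightarrow> L) (at_right 0)" "c < L"
  obtains x where "0 < x" "x < pi / 2" "c < f x"
proof -
  have "eventually (\<lambda>x. c < f x \<and> x \<in> {0<..<pi / 2}) (at_right 0)"
    using assms by (intro eventually_conj order_tendstoD(1) eventually_at_right_real) auto
  from eventually_happens'[OF _ this] that show thesis by auto
qed

lemma falls_below_above_left_limit_pi_half:
  fixes f :: "real \<Rightarrow> real"
  assumes "(f \<longlongrightarrow> L) (at_left (pi / 2))" "L < c"
  obtains x where "0 < x" "x < pi / 2" "f x < c"
proof -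
  have "eventually (\<lambda>x. f x < c \<and> x \<in> {0<..<pi / 2}) (at_left (pi / 2))"
    using assms by (intro eventually_conj order_tendstoD(2) eventually_at_left_real) auto
  from eventually_happens'[OF _ this] that show thesis by auto
qed

lemma sandor_mean_geom_bounds:
  assumes "0 < a" "0 < b" "a \<noteq> b"
  shows "2 / 3 * geom_mean a b + (1 - 2 / 3) * arith_mean a b < sandor_mean a b"
    and "sandor_mean a b
      < (exp 1 - 1) / exp 1 * geom_mean a b + (1 - (exp 1 - 1) / exp 1) * arith_mean a b"
proof -
  obtain x where x: "0 < x" "x < pi / 2" and G: "geom_mean a b = arith_mean a b * cos x"
    and X: "sandor_mean a b = arith_mean a b * sandor_profile x"
    using means_eq_arith_mean_mult[OF assms] by metis
  have A: "0 < arith_mean a b" using assms by (simp add: arith_mean_def)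
  have scale: "c * (arith_mean a b * cos x) + (1 - c) * arith_mean a b
      = arith_mean a b * (c * cos x + (1 - c))" for c
    by (simp add: algebra_simps)
  show "2 / 3 * geom_mean a b + (1 - 2 / 3) * arith_mean a b < sandor_mean a b"
    unfolding G X scale
    using bounds_geom_quotient(2)[OF x] geom_quotient_less_iff(1)[OF x] A
    by (intro mult_strict_left_mono) blast+
  show "sandor_mean a b
      < (exp 1 - 1) / exp 1 * geom_mean a b + (1 - (exp 1 - 1) / exp 1) * arith_mean a b"
    unfolding G X scale
    using bounds_geom_quotient(1)[OF x] geom_quotient_less_iff(2)[OF x] A
    by (intro mult_strict_left_mono) blast+
qed

lemma sandor_mean_seiffert_bounds:
  assumes "0 < a" "0 < b" "a \<noteq> b"
  shows "arith_mean a b + geom_mean a b - 1 * seiffert_mean a b < sandor_mean a b"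
    and "sandor_mean a b < arith_mean a b + geom_mean a b
      - pi * (exp 1 - 1) / (2 * exp 1) * seiffert_mean a b"
proof -
  obtain x where x: "0 < x" "x < pi / 2" and G: "geom_mean a b = arith_mean a b * cos x"
    and P: "seiffert_mean a b = arith_mean a b * (sin x / x)"
    and X: "sandor_mean a b = arith_mean a b * sandor_profile x"
    using means_eq_arith_mean_mult[OF assms] by metis
  have A: "0 < arith_mean a b" using assms by (simp add: arith_mean_def)
  have scale: "arith_mean a b + arith_mean a b * cos x - c * (arith_mean a b * (sin x / x))
      = arith_mean a b * (1 + cos x - c * (sin x / x))" for c
    by (simp add: algebra_simps)
  show "arith_mean a b + geom_mean a b - 1 * seiffert_mean a b < sandor_mean a b"
    unfolding G P X scale
    using bounds_seiffert_quotient(2)[OF x] seiffert_quotient_less_iff(1)[OF x] A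
    by (intro mult_strict_left_mono) blast+
  show "sandor_mean a b < arith_mean a b + geom_mean a b
      - pi * (exp 1 - 1) / (2 * exp 1) * seiffert_mean a b"
    unfolding G P X scale
    using bounds_seiffert_quotient(1)[OF x] seiffert_quotient_less_iff(2)[OF x] A
    by (intro mult_strict_left_mono) blast+
qed

text \<open>
  Being best possible: a constant smaller than the limit of the quotient at \<open>0\<close> is exceeded by the
  quotient near \<open>0\<close>, and one larger than the limit at \<open>\<pi>/2\<close> exceeds it near \<open>\<pi>/2\<close>; the pair
  \<open>a = 1 + sin x\<close>, \<open>b = 1 - sin x\<close> then violates the comparison.
\<close>

lemma geom_lower_bound_best_possible:
  assumes "\<alpha> < 2 / 3"
  shows "\<exists>a b. 0 < a \<and> 0 < b \<and> a \<noteq> b \<and>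
    sandor_mean a b < \<alpha> * geom_mean a b + (1 - \<alpha>) * arith_mean a b"
proof -
  obtain x where x: "0 < x" "x < pi / 2" "\<alpha> < geom_quotient x"
    using exceeds_below_right_limit_0[OF geom_quotient_tendsto_0 assms] .
  show ?thesis
    using x geom_quotient_less_iff(2)[of x \<alpha>] means_of_one_plus_minus_sin[of x]
    by (intro exI[of _ "1 + sin x"] exI[of _ "1 - sin x"]) simp
qed

lemma geom_upper_bound_best_possible:
  assumes "(exp 1 - 1) / exp 1 < \<beta>"
  shows "\<exists>a b. 0 < a \<and> 0 < b \<and> a \<noteq> b \<and>
    \<beta> * geom_mean a b + (1 - \<beta>) * arith_mean a b < sandor_mean a b"
proof -
  obtain x where x: "0 < x" "x < pi / 2" "geom_quotient x < \<beta>"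
    using falls_below_above_left_limit_pi_half[OF geom_quotient_tendsto_pi_half assms] .
  show ?thesis
    using x geom_quotient_less_iff(1)[of x \<beta>] means_of_one_plus_minus_sin[of x]
    by (intro exI[of _ "1 + sin x"] exI[of _ "1 - sin x"]) simp
qed

lemma seiffert_lower_bound_best_possible:
  assumes "\<alpha> < 1"
  shows "\<exists>a b. 0 < a \<and> 0 < b \<and> a \<noteq> b \<and>
    sandor_mean a b < arith_mean a b + geom_mean a b - \<alpha> * seiffert_mean a b"
proof -
  obtain x where x: "0 < x" "x < pi / 2" "\<alpha> < seiffert_quotient x"
    using exceeds_below_right_limit_0[OF seiffert_quotient_tendsto_0 assms] .
  show ?thesis
    using x seiffert_quotient_less_iff(2)[of x \<alpha>] means_of_one_plus_minus_sin[of x]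
    by (intro exI[of _ "1 + sin x"] exI[of _ "1 - sin x"]) simp
qed

lemma seiffert_upper_bound_best_possible:
  assumes "pi * (exp 1 - 1) / (2 * exp 1) < \<beta>"
  shows "\<exists>a b. 0 < a \<and> 0 < b \<and> a \<noteq> b \<and>
    arith_mean a b + geom_mean a b - \<beta> * seiffert_mean a b < sandor_mean a b"
proof -
  obtain x where x: "0 < x" "x < pi / 2" "seiffert_quotient x < \<beta>"
    using falls_below_above_left_limit_pi_half[OF seiffert_quotient_tendsto_pi_half assms] .
  show ?thesis
    using x seiffert_quotient_less_iff(1)[of x \<beta>] means_of_one_plus_minus_sin[of x]
    by (intro exI[of _ "1 + sin x"] exI[of _ "1 - sin x"]) simp
qed

theorem theorem1p4:
  shows
    "(\<forall>a b :: real. a > 0 \<longrightarrow> b > 0 \<longrightarrow> a \<noteq> b \<longrightarrow>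
       2 / 3 * geom_mean a b + (1 - 2 / 3) * arith_mean a b < sandor_mean a b \<and>
       sandor_mean a b
         < (exp 1 - 1) / exp 1 * geom_mean a b + (1 - (exp 1 - 1) / exp 1) * arith_mean a b) \<and>
     (\<forall>\<alpha> :: real. \<alpha> < 2 / 3 \<longrightarrow>
       \<not> (\<forall>a b :: real. a > 0 \<longrightarrow> b > 0 \<longrightarrow> a \<noteq> b \<longrightarrow>
            \<alpha> * geom_mean a b + (1 - \<alpha>) * arith_mean a b < sandor_mean a b)) \<and>
     (\<forall>\<beta> :: real. \<beta> > (exp 1 - 1) / exp 1 \<longrightarrow>
       \<not> (\<forall>a b :: real. a > 0 \<longrightarrow> b > 0 \<longrightarrow> a \<noteq> b \<longrightarrow>
            sandor_mean a b < \<beta> * geom_mean a b + (1 - \<beta>) * arith_mean a b)) \<and>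
     (\<forall>a b :: real. a > 0 \<longrightarrow> b > 0 \<longrightarrow> a \<noteq> b \<longrightarrow>
       arith_mean a b + geom_mean a b - 1 * seiffert_mean a b < sandor_mean a b \<and>
       sandor_mean a b
         < arith_mean a b + geom_mean a b - pi * (exp 1 - 1) / (2 * exp 1) * seiffert_mean a b) \<and>
     (\<forall>\<alpha>\<^sub>1 :: real. \<alpha>\<^sub>1 < 1 \<longrightarrow>
       \<not> (\<forall>a b :: real. a > 0 \<longrightarrow> b > 0 \<longrightarrow> a \<noteq> b \<longrightarrow>
            arith_mean a b + geom_mean a b - \<alpha>\<^sub>1 * seiffert_mean a b < sandor_mean a b)) \<and>
     (\<forall>\<beta>\<^sub>1 :: real. \<beta>\<^sub>1 > pi * (exp 1 - 1) / (2 * exp 1) \<longrightarrow>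
       \<not> (\<forall>a b :: real. a > 0 \<longrightarrow> b > 0 \<longrightarrow> a \<noteq> b \<longrightarrow>
            sandor_mean a b < arith_mean a b + geom_mean a b - \<beta>\<^sub>1 * seiffert_mean a b))"
proof (intro conjI allI impI)
  show "\<not> (\<forall>a b :: real. a > 0 \<longrightarrow> b > 0 \<longrightarrow> a \<noteq> b \<longrightarrow>
      \<alpha> * geom_mean a b + (1 - \<alpha>) * arith_mean a b < sandor_mean a b)"
    if "\<alpha> < 2 / 3" for \<alpha>
    using geom_lower_bound_best_possible[OF that] by (meson less_asym)
  show "\<not> (\<forall>a b :: real. a > 0 \<longrightarrow> b > 0 \<longrightarrow> a \<noteq> b \<longrightarrow>
      sandor_mean a b < \<beta> * geom_mean a b + (1 - \<beta>) * arith_mean a b)"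
    if "\<beta> > (exp 1 - 1) / exp 1" for \<beta>
    using geom_upper_bound_best_possible[OF that] by (meson less_asym)
  show "\<not> (\<forall>a b :: real. a > 0 \<longrightarrow> b > 0 \<longrightarrow> a \<noteq> b \<longrightarrow>
      arith_mean a b + geom_mean a b - \<alpha> * seiffert_mean a b < sandor_mean a b)"
    if "\<alpha> < 1" for \<alpha>
    using seiffert_lower_bound_best_possible[OF that] by (meson less_asym)
  show "\<not> (\<forall>a b :: real. a > 0 \<longrightarrow> b > 0 \<longrightarrow> a \<noteq> b \<longrightarrow>
      sandor_mean a b < arith_mean a b + geom_mean a b - \<beta> * seiffert_mean a b)"
    if "\<beta> > pi * (exp 1 - 1) / (2 * exp 1)" for \<beta>
    using seiffert_upper_bound_best_possible[OF that] by (meson less_asym)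
qed (fact sandor_mean_geom_bounds sandor_mean_seiffert_bounds)+

end
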